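(* For every name $Q$: if $\eta\,Q\,\mathrm{Solid}$, then there exists a name $R$ such that $\eta\,R\,(\mathrm{klass}(\mathrm{InteriorPoint}(Q)))$.
   Context: Logic is classical. Names form a type $N$; a name may designate zero, one or several objects. The relation $\eta : N\to N\to \mathrm{Prop}$ (singular inclusion) is governed by Leśniewski's Ontology: $\eta\,A\,b$ holds iff [there is $C$ with $\eta\,C\,A$] and [for all $C,D$, $\eta\,C\,A$ and $\eta\,D\,A$ imply $\eta\,C\,D$] and [for all $C$, $\eta\,C\,A$ implies $\eta\,C\,b$]; i.e. $A$ designates exactly one object, which is among those designated by $b$. $A$ is an Individual iff $\eta\,A\,A$. Notation: $P\equiv Q$ iff $\eta\,P\,Q$ and $\eta\,Q\,P$; $a\approx b$ iff $\forall P,\ \eta\,P\,a\leftrightarrow\eta\,P\,b$; $a\subseteq b$ iff $\forall P,\ \eta\,P\,a\to\eta\,P\,b$. Names with the same extension are interchangeable. Name-forming operators are introduced by stating when $\eta\,P\,(\cdot)$ holds. Mereology: $\eta\,P\,(\mathrm{pt}(Q))$ ("$P$ is a part of $Q$") relates individuals and is reflexive on individuals, transitive, and antisymmetric up to $\equiv$; $\eta\,P\,(\mathrm{ppt}(Q))$ (proper part) means $\eta\,P\,(\mathrm{pt}(Q))$ and not $P\equiv Q$; $\eta\,P\,(\mathrm{ext}(Q))$ means $P,Q$ are individuals with no common part. $\eta\,A\,(\mathrm{klass}(a))$ iff $A$ is an Individual, every $B$ with $\eta\,B\,a$ satisfies $\eta\,B\,(\mathrm{pt}(A))$, and for every $B$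 with $\eta\,B\,(\mathrm{pt}(A))$ there exist $C,D$ with $\eta\,C\,a$, $\eta\,D\,(\mathrm{pt}(C))$, $\eta\,D\,(\mathrm{pt}(B))$. If some $C$ satisfies $\eta\,C\,a$, then there is $A$ with $\eta\,A\,(\mathrm{klass}(a))$, unique up to $\equiv$. Geometry: $\mathrm{balls}$ is a primitive name whose members are individuals (balls); at least one ball exists. $\eta\,P\,(\mathrm{Concent}(Q))$ means that the balls $P,Q$ are concentric in Tarski's sense: $P\equiv Q$; or $P$ is a proper part of $Q$ and any two balls $X,Y$ externally diametrical to $P$ and internally tangent to $Q$ are internally diametrical to $Q$; or the same with $P,Q$ exchanged. Here (all variables balls): $A$ is externally tangent to $B$ if $A$ is external to $B$ and of any two balls $X,Y$ having $A$ as part and external to $B$ one is part of the other; $A$ is internally tangent to $B$ if $A$ is a proper part of $B$ and of any two balls $X,Y$ having $A$ as part and being parts of $B$ one is part of the other; $A,B$ are externally diametrical to $C$ if both are externally tangent to $C$ and whenever $X,Y$ are external to $C$, $A$ is part of $X$ and $B$ is part of $Y$, then $X$ is external to $Y$; $A,B$ are internally diametrical to $C$ if both are internally tangent to $C$ and whenever $X,Y$ are external to $C$, $A$ is externally tangent to $X$ and $B$ to $Y$, then $X$ is external to $Y$. $\eta\,P\,(\mathrm{Point}(Q))$ iff $\eta\,P\,\mathrm{balls}$, $\eta\,Q\,\mathrm{balls}$ and $\eta\,P\,(\mathrm{Concent}(Q))$. Standing assumptions: concentricity is an equivalence relation on balls, and concentric balls $P,Q$ satisfy $\mathrm{Point}(P)\approx\mathrm{Point}(Q)$.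 $\eta\,P\,\mathrm{Solid}$ iff $P$ is an Individual and there is $b\subseteq\mathrm{balls}$ with $\eta\,P\,(\mathrm{klass}(b))$; parts of solids are assumed to be solids. $\eta\,P\,(\mathrm{InteriorPoint}(Q))$ iff $\eta\,Q\,\mathrm{Solid}$ and there is $P'$ with $\eta\,P\,(\mathrm{Point}(P'))$ and $\eta\,P'\,(\mathrm{pt}(Q))$. *)

theory Defs
  imports Main
begin

text \<open>
  The names form the type \<^typ>\<open>'n\<close>, and \<open>\<eta>\<close> is singular inclusion. Following Lesniewski, a
  name-forming operator is introduced by stating when \<open>\<eta> P (\<dots>)\<close> holds: such operators are locale
  parameters, and their definitions are the locale assumptions named \<open>\<dots>_iff\<close>.
\<close>

locale singular_inclusion =
  fixes \<eta> :: "'n \<Rightarrow> 'n \<Rightarrow> bool"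
begin

definition individual :: "'n \<Rightarrow> bool" where
  "individual A \<longleftrightarrow> \<eta> A A"

definition same_individual :: "'n \<Rightarrow> 'n \<Rightarrow> bool" (infix "\<simeq>" 50) where
  "P \<simeq> Q \<longleftrightarrow> \<eta> P Q \<and> \<eta> Q P"

definition same_extension :: "'n \<Rightarrow> 'n \<Rightarrow> bool" (infix "\<approx>" 50) where
  "a \<approx> b \<longleftrightarrow> (\<forall>P. \<eta> P a \<longleftrightarrow> \<eta> P b)"

definition weak_inclusion :: "'n \<Rightarrow> 'n \<Rightarrow> bool" (infix "\<sqsubseteq>" 50) where
  "a \<sqsubseteq> b \<longleftrightarrow> (\<forall>P. \<eta> P a \<longrightarrow> \<eta> P b)"

end

text \<open>
  Interchangeability of names with the same extension in every context is equality in HOL.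
\<close>

locale ontology = singular_inclusion \<eta> for \<eta> :: "'n \<Rightarrow> 'n \<Rightarrow> bool" +
  assumes ontology_axiom:
    "\<eta> A b \<longleftrightarrow> (\<exists>C. \<eta> C A) \<and> (\<forall>C D. \<eta> C A \<and> \<eta> D A \<longrightarrow> \<eta> C D) \<and> (\<forall>C. \<eta> C A \<longrightarrow> \<eta> C b)"
  and extensionality: "a \<approx> b \<Longrightarrow> a = b"

locale mereology = ontology \<eta> for \<eta> :: "'n \<Rightarrow> 'n \<Rightarrow> bool" +
  fixes pt ppt ext klass :: "'n \<Rightarrow> 'n"
  assumes pt_individuals: "\<eta> P (pt Q) \<Longrightarrow> individual P \<and> individual Q"
    and pt_refl: "individual P \<Longrightarrow> \<eta> P (pt P)"
    and pt_trans: "\<eta> P (pt Q) \<Longrightarrow> \<eta> Q (pt R) \<Longrightarrow> \<eta> P (pt R)"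
    and pt_antisym: "\<eta> P (pt Q) \<Longrightarrow> \<eta> Q (pt P) \<Longrightarrow> P \<simeq> Q"
    and ppt_iff: "\<eta> P (ppt Q) \<longleftrightarrow> \<eta> P (pt Q) \<and> \<not> P \<simeq> Q"
    and ext_iff: "\<eta> P (ext Q) \<longleftrightarrow>
          individual P \<and> individual Q \<and> \<not> (\<exists>R. \<eta> R (pt P) \<and> \<eta> R (pt Q))"
    and klass_iff: "\<eta> A (klass a) \<longleftrightarrow>
          individual A \<and> (\<forall>B. \<eta> B a \<longrightarrow> \<eta> B (pt A)) \<and>
          (\<forall>B. \<eta> B (pt A) \<longrightarrow> (\<exists>C D. \<eta> C a \<and> \<eta> D (pt C) \<and> \<eta> D (pt B)))"
    and klass_exists: "\<eta> C a \<Longrightarrow> \<exists>A. \<eta> A (klass a)"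
    and klass_unique: "\<eta> C a \<Longrightarrow> \<eta> A (klass a) \<Longrightarrow> \<eta> B (klass a) \<Longrightarrow> A \<simeq> B"

locale mereology_with_balls = mereology \<eta> pt ppt ext klass
  for \<eta> :: "'n \<Rightarrow> 'n \<Rightarrow> bool" and pt ppt ext klass :: "'n \<Rightarrow> 'n" +
  fixes balls :: 'n
  assumes balls_individuals: "\<eta> B balls \<Longrightarrow> individual B"
    and balls_nonempty: "\<exists>B. \<eta> B balls"
begin

abbreviation ball :: "'n \<Rightarrow> bool" where
  "ball B \<equiv> \<eta> B balls"

definition ext_tangent :: "'n \<Rightarrow> 'n \<Rightarrow> bool" where
  "ext_tangent A B \<longleftrightarrow> ball A \<and> ball B \<and> \<eta> A (ext B) \<and>
     (\<forall>X Y. ball X \<and> ball Y \<and> \<eta> A (pt X) \<and> \<eta> X (ext B) \<and> \<eta> A (pt Y) \<and> \<eta> Y (ext B)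
        \<longrightarrow> \<eta> X (pt Y) \<or> \<eta> Y (pt X))"

definition int_tangent :: "'n \<Rightarrow> 'n \<Rightarrow> bool" where
  "int_tangent A B \<longleftrightarrow> ball A \<and> ball B \<and> \<eta> A (ppt B) \<and>
     (\<forall>X Y. ball X \<and> ball Y \<and> \<eta> A (pt X) \<and> \<eta> X (pt B) \<and> \<eta> A (pt Y) \<and> \<eta> Y (pt B)
        \<longrightarrow> \<eta> X (pt Y) \<or> \<eta> Y (pt X))"

definition ext_diametrical :: "'n \<Rightarrow> 'n \<Rightarrow> 'n \<Rightarrow> bool" where
  "ext_diametrical A B C \<longleftrightarrow> ext_tangent A C \<and> ext_tangent B C \<and>
     (\<forall>X Y. ball X \<and> ball Y \<and> \<eta> X (ext C) \<and> \<eta> Y (ext C) \<and> \<eta> A (pt X) \<and> \<eta> B (pt Y)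
        \<longrightarrow> \<eta> X (ext Y))"

definition int_diametrical :: "'n \<Rightarrow> 'n \<Rightarrow> 'n \<Rightarrow> bool" where
  "int_diametrical A B C \<longleftrightarrow> int_tangent A C \<and> int_tangent B C \<and>
     (\<forall>X Y. ball X \<and> ball Y \<and> \<eta> X (ext C) \<and> \<eta> Y (ext C) \<and> ext_tangent A X \<and> ext_tangent B Y
        \<longrightarrow> \<eta> X (ext Y))"

definition concentric_inside :: "'n \<Rightarrow> 'n \<Rightarrow> bool" where
  "concentric_inside P Q \<longleftrightarrow> \<eta> P (ppt Q) \<and>
     (\<forall>X Y. ball X \<and> ball Y \<and> ext_diametrical X Y P \<and> int_tangent X Q \<and> int_tangent Y Q
        \<longrightarrow> int_diametrical X Y Q)"

end

text \<open>
  As in Tarski's geometry of solids, a point is represented by the balls concentric with a given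
  ball: the members of \<open>Point Q\<close> are balls, and \<open>Point Q\<close> designates all of them.
\<close>

locale solid_geometry = mereology_with_balls \<eta> pt ppt ext klass balls
  for \<eta> :: "'n \<Rightarrow> 'n \<Rightarrow> bool" and pt ppt ext klass :: "'n \<Rightarrow> 'n" and balls :: 'n +
  fixes Concent Point :: "'n \<Rightarrow> 'n" and Solid :: 'n and InteriorPoint :: "'n \<Rightarrow> 'n"
  assumes Concent_iff: "\<eta> P (Concent Q) \<longleftrightarrow>
          ball P \<and> ball Q \<and> (P \<simeq> Q \<or> concentric_inside P Q \<or> concentric_inside Q P)"
    and Point_iff: "\<eta> P (Point Q) \<longleftrightarrow> ball P \<and> ball Q \<and> \<eta> P (Concent Q)"
    and Concent_equiv: "equiv {B. ball B} {(P, Q). \<eta> P (Concent Q)}"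
    and Point_cong: "\<eta> P (Concent Q) \<Longrightarrow> Point P \<approx> Point Q"
    and Solid_iff: "\<eta> P Solid \<longleftrightarrow> individual P \<and> (\<exists>b. b \<sqsubseteq> balls \<and> \<eta> P (klass b))"
    and Solid_part: "\<eta> P Solid \<Longrightarrow> \<eta> Q (pt P) \<Longrightarrow> \<eta> Q Solid"
    and InteriorPoint_iff: "\<eta> P (InteriorPoint Q) \<longleftrightarrow>
          \<eta> Q Solid \<and> (\<exists>P'. \<eta> P (Point P') \<and> \<eta> P' (pt Q))"

end

theory Submission
  imports Defs
begin

text \<open>
  A class of a name exists as soon as the name designates something, so it suffices to find one
  interior point. A solid is a class of balls and a part of itself; the overlap clause of
  \<open>klass\<close>, applied to this improper part, yields a ball among those that compose the solid,
  and such a ball is a part of it. Being concentric with itself, the ball is one of the balls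
  that represent its centre, which is therefore interior to the solid.
\<close>

lemma (in mereology) klass_has_member_part:
  assumes "\<eta> A (klass a)"
  obtains C where "\<eta> C a" "\<eta> C (pt A)"
proof -
  have "\<eta> A (pt A)"
    using assms klass_iff pt_refl by blast
  then show thesis
    using assms klass_iff that by blast
qed

lemma (in solid_geometry) solid_contains_ball:
  assumes "\<eta> Q Solid"
  obtains C where "ball C" "\<eta> C (pt Q)"
proof -
  obtain b where "b \<sqsubseteq> balls" "\<eta> Q (klass b)"
    using assms Solid_iff by blast
  then show thesis
    using klass_has_member_part that weak_inclusion_def by metis
qed

lemma (in solid_geometry) ball_in_own_Point:
  assumes "ball C"
  shows "\<eta> C (Point C)"
  using assms balls_individuals
  by (simp add: Point_iff Concent_iff same_individual_def individual_def)

theorem theorem8: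
  fixes \<eta> :: "'n \<Rightarrow> 'n \<Rightarrow> bool"
    and pt ppt ext klass Concent Point InteriorPoint :: "'n \<Rightarrow> 'n"
    and balls Solid Q :: 'n
  assumes "solid_geometry \<eta> pt ppt ext klass balls Concent Point Solid InteriorPoint"
    and "\<eta> Q Solid"
  shows "\<exists>R. \<eta> R (klass (InteriorPoint Q))"
proof -
  interpret solid_geometry \<eta> pt ppt ext klass balls Concent Point Solid InteriorPoint
    by (fact assms(1))
  obtain C where "ball C" "\<eta> C (pt Q)"
    using assms(2) by (rule solid_contains_ball)
  then have "\<eta> C (InteriorPoint Q)"
    using assms(2) ball_in_own_Point InteriorPoint_iff by blast
  then show ?thesis
    by (rule klass_exists)
qed

end
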